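(* Let $X$ be a complete convex metric space (for example a complete $\mathrm{CAT}(0)$ space), let $\mathcal{C}$ be a finite collection of closed convex subsets of $X$, and let $\mathcal{N}(\mathcal{C})$ be its nerve. If $\dim(X)\le d$, where $d\ge 0$ is an integer, then every continuous map $\mathcal{N}(\mathcal{C})\to\mathbb{S}^r$ to a sphere of dimension $r\ge d$ is homotopic to a constant map.
   Context: A convex metric space is a (non-empty) geodesic metric space $X$ such that for any pair of geodesics $c_1,c_2:[0,1]\to X$ parameterized proportional to arc length, the function $t\mapsto d(c_1(t),c_2(t))$ is convex; in such a space any two points $x,y$ are joined by a unique geodesic segment $[x,y]$. A subset $Y\subseteq X$ is convex if $[y,y']\subseteq Y$ for all $y,y'\in Y$. The nerve $\mathcal{N}(\mathcal{C})$ is the (geometric realization of the) simplicial complex whose $k$-simplices $[i_0,\dots,i_k]$ correspond to sub-collections $\{C_{i_0},\dots,C_{i_k}\}\subseteq\mathcal{C}$ with non-empty intersection. Dimension is topological: $\dim(X)\le d$ if for every closed subspace $K\subseteq X$ and every $r\ge d$, every continuous map $K\to\mathbb{S}^r$ to the $r$-sphere extends to a continuous map $X\to\mathbb{S}^r$. *)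

theory Defs
  imports "HOL-Analysis.Analysis"
begin

section \<open>Convex metric spaces\<close>

text \<open>
  A metric space is a set X in a type of class \<open>metric_space\<close>, with the induced distance.
  A geodesic is parameterized on [0,1] proportionally to arc length; the factor l is its length,
  and l = 0 (a constant path) is allowed.
\<close>

definition geodesic_in :: "'a::metric_space set \<Rightarrow> (real \<Rightarrow> 'a) \<Rightarrow> bool" where
  "geodesic_in X c \<longleftrightarrow>
     c ` {0..1} \<subseteq> X \<and> (\<exists>l. \<forall>s\<in>{0..1}. \<forall>t\<in>{0..1}. dist (c s) (c t) = l * \<bar>s - t\<bar>)"

definition geodesic_metric_space :: "'a::metric_space set \<Rightarrow> bool" where
  "geodesic_metric_space X \<longleftrightarrow>
     (\<forall>x\<in>X. \<forall>y\<in>X. \<exists>c. geodesic_in X c \<and> c 0 = x \<and> c 1 = y)"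

definition convex_metric_space :: "'a::metric_space set \<Rightarrow> bool" where
  "convex_metric_space X \<longleftrightarrow>
     X \<noteq> {} \<and> geodesic_metric_space X \<and>
     (\<forall>c1 c2. geodesic_in X c1 \<longrightarrow> geodesic_in X c2 \<longrightarrow>
        convex_on {0..1} (\<lambda>t. dist (c1 t) (c2 t)))"

text \<open>
  The union of all geodesics from x to y. In a convex metric space there is exactly one of them up
  to its values outside [0,1] (\<open>geodesic_unique\<close>), so this is the segment [x,y]
  (\<open>geodesic_segment_eq\<close>).
\<close>

definition geodesic_segment :: "'a::metric_space set \<Rightarrow> 'a \<Rightarrow> 'a \<Rightarrow> 'a set" where
  "geodesic_segment X x y = \<Union> {c ` {0..1} | c. geodesic_in X c \<and> c 0 = x \<and> c 1 = y}"

definition geodesically_convex :: "'a::metric_space set \<Rightarrow> 'a set \<Rightarrow> bool" where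
  "geodesically_convex X Y \<longleftrightarrow>
     Y \<subseteq> X \<and> (\<forall>y\<in>Y. \<forall>y'\<in>Y. geodesic_segment X y y' \<subseteq> Y)"

lemma geodesic_unique:
  assumes X: "convex_metric_space X"
    and c: "geodesic_in X c" "geodesic_in X c'" "c 0 = c' 0" "c 1 = c' 1"
    and t: "t \<in> {0..1}"
  shows "c t = c' t"
proof -
  have "convex_on {0..1} (\<lambda>t. dist (c t) (c' t))"
    using X c unfolding convex_metric_space_def by blast
  from convex_onD[OF this, of t 0 1] t c have "dist (c t) (c' t) \<le> 0"
    by simp
  then show ?thesis by simp
qed

lemma geodesic_segment_eq:
  assumes "convex_metric_space X" "geodesic_in X c" "c 0 = x" "c 1 = y"
  shows "geodesic_segment X x y = c ` {0..1}"
proof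
  show "c ` {0..1} \<subseteq> geodesic_segment X x y"
    using assms unfolding geodesic_segment_def by blast
  have "c' ` {0..1} \<subseteq> c ` {0..1}" if "geodesic_in X c'" "c' 0 = x" "c' 1 = y" for c'
    using geodesic_unique[OF assms(1) that(1) assms(2)] that assms by auto
  then show "geodesic_segment X x y \<subseteq> c ` {0..1}"
    unfolding geodesic_segment_def by blast
qed

section \<open>Nerves and their geometric realization\<close>

text \<open>
  The abstract simplicial complex, as the set of its (non-empty, finite) simplices. Its vertices are
  the non-empty members of \<open>\<C>\<close>.
\<close>

definition nerve_complex :: "'a set set \<Rightarrow> 'a set set set" where
  "nerve_complex \<C> = {\<sigma>. \<sigma> \<subseteq> \<C> \<and> finite \<sigma> \<and> \<sigma> \<noteq> {} \<and> \<Inter>\<sigma> \<noteq> {}}"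

text \<open>
  Points are given by barycentric coordinates, with support a simplex. The topology is the one
  of pointwise convergence of coordinates; for a complex with finitely many vertices it is
  the usual one (for infinite complexes it would differ from the weak topology).
\<close>

definition geometric_realization :: "'v set set \<Rightarrow> ('v \<Rightarrow> real) topology" where
  "geometric_realization K =
     subtopology (powertop_real UNIV)
       {x. (\<forall>v. 0 \<le> x v) \<and> {v. x v \<noteq> 0} \<in> K \<and> (\<Sum>v | x v \<noteq> 0. x v) = 1}"

definition nerve :: "'a set set \<Rightarrow> ('a set \<Rightarrow> real) topology" where
  "nerve \<C> = geometric_realization (nerve_complex \<C>)"

section \<open>Dimension via extension of maps to spheres\<close>

definition top_dim_le :: "'a topology \<Rightarrow> nat \<Rightarrow> bool" where
  "top_dim_le X d \<longleftrightarrow>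
     (\<forall>K r f. closedin X K \<longrightarrow> d \<le> r \<longrightarrow> continuous_map (subtopology X K) (nsphere r) f \<longrightarrow>
        (\<exists>g. continuous_map X (nsphere r) g \<and> (\<forall>x\<in>K. g x = f x)))"

end

theory Submission
  imports Defs
begin

text \<open>
  The union \<open>Y = \<Union>\<C>\<close> dominates the nerve up to homotopy: there are maps
  \<open>\<phi>\<close> from the nerve to \<open>Y\<close> and \<open>\<psi>\<close> from \<open>Y\<close> to the nerve with
  \<open>\<psi> \<circ> \<phi>\<close> homotopic to the identity (\<open>nerve_homotopy_retract\<close>). Given this, a map
  \<open>f\<close> from the nerve to a sphere of dimension at least \<open>d\<close> is homotopic to
  \<open>f \<circ> \<psi> \<circ> \<phi>\<close>. Since \<open>Y\<close> is closed in \<open>X\<close>, the dimension bound extends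
  \<open>f \<circ> \<psi>\<close> to a map \<open>g\<close> on all of \<open>X\<close>. Contracting \<open>X\<close> along geodesics to a
  point makes \<open>g\<close> null-homotopic, hence so is \<open>f\<close>.

  The map \<open>\<phi>\<close> sends the barycenter of a simplex \<open>\<sigma>\<close> to a point of
  \<open>\<Inter>\<sigma>\<close> and extends over the barycentric subdivision by geodesic convex combinations
  (\<open>convex_combination_map\<close>). A point \<open>x\<close> then lands in each member of \<open>\<C>\<close>
  at which the coordinate of \<open>x\<close> is largest, by convexity of that member. The map \<open>\<psi>\<close>
  is a normalized family of weights \<open>u C\<close>, positive on \<open>C\<close>, such that the sets where
  they are positive intersect only if the members of \<open>\<C>\<close> do; closed sets in a metric space
  always have such weights (\<open>swelling_weight\<close>).

  The points \<open>x\<close> and \<open>\<psi> (\<phi> x)\<close> need not lie in a common simplex. But the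
  point with coordinates proportional to \<open>x C * u C (\<phi> x)\<close> shares a simplex with each of
  them, and two straight-line homotopies give the result.
\<close>

section \<open>Geodesics depend continuously on their endpoints\<close>

definition geodesic_point :: "'a::metric_space set \<Rightarrow> 'a \<Rightarrow> 'a \<Rightarrow> real \<Rightarrow> 'a" where
  "geodesic_point X x y = (SOME c. geodesic_in X c \<and> c 0 = x \<and> c 1 = y)"

lemma geodesic_point:
  assumes "convex_metric_space X" "x \<in> X" "y \<in> X"
  shows "geodesic_in X (geodesic_point X x y)" "geodesic_point X x y 0 = x"
    "geodesic_point X x y 1 = y"
proof -
  have "\<exists>c. geodesic_in X c \<and> c 0 = x \<and> c 1 = y"
    using assms unfolding convex_metric_space_def geodesic_metric_space_def by blast
  from someI_ex[OF this] show "geodesic_in X (geodesic_point X x y)" "geodesic_point X x y 0 = x"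
    "geodesic_point X x y 1 = y"
    unfolding geodesic_point_def by auto
qed

lemma geodesic_point_in:
  assumes "convex_metric_space X" "x \<in> X" "y \<in> X" "t \<in> {0..1}"
  shows "geodesic_point X x y t \<in> X"
  using geodesic_point(1)[OF assms(1-3)] assms(4) by (auto simp: geodesic_in_def)

lemma geodesic_point_in_convex:
  assumes "convex_metric_space X" "geodesically_convex X Z" "x \<in> Z" "y \<in> Z" "t \<in> {0..1}"
  shows "geodesic_point X x y t \<in> Z"
proof -
  have "x \<in> X" "y \<in> X"
    using assms unfolding geodesically_convex_def by auto
  then have "geodesic_point X x y t \<in> geodesic_segment X x y"
    using geodesic_segment_eq[OF assms(1) geodesic_point[OF assms(1)]] assms(5) by simp
  then show ?thesis
    using assms(2-4) by (auto simp: geodesically_convex_def)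
qed

lemma dist_geodesic_point_same:
  assumes X: "convex_metric_space X" "x \<in> X" "y \<in> X" and st: "s \<in> {0..1}" "t \<in> {0..1}"
  shows "dist (geodesic_point X x y s) (geodesic_point X x y t) = dist x y * \<bar>s - t\<bar>"
proof -
  note c = geodesic_point[OF X]
  obtain l where l: "\<forall>s\<in>{0..1}. \<forall>t\<in>{0..1}.
      dist (geodesic_point X x y s) (geodesic_point X x y t) = l * \<bar>s - t\<bar>"
    using c(1) unfolding geodesic_in_def by blast
  from l[rule_format, of 0 1] c have "dist x y = l" by simp
  with l st show ?thesis by simp
qed

lemma dist_geodesics_le:
  assumes "convex_metric_space X" "geodesic_in X c" "geodesic_in X c'" "t \<in> {0..1}"
  shows "dist (c t) (c' t) \<le> (1 - t) * dist (c 0) (c' 0) + t * dist (c 1) (c' 1)"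
proof -
  have "convex_on {0..1} (\<lambda>t. dist (c t) (c' t))"
    using assms unfolding convex_metric_space_def by blast
  from convex_onD[OF this, of t 0 1] assms(4) show ?thesis by simp
qed

text \<open>
  The distance from a constant geodesic to another geodesic is convex in the parameter, so it is
  largest at an endpoint.
\<close>

lemma geodesically_convex_cball:
  assumes X: "convex_metric_space X" and p: "p \<in> X"
  shows "geodesically_convex X (X \<inter> cball p R)"
  unfolding geodesically_convex_def
proof (intro conjI ballI)
  fix x y assume xy: "x \<in> X \<inter> cball p R" "y \<in> X \<inter> cball p R"
  have const: "geodesic_in X (\<lambda>_. p)"
    using p unfolding geodesic_in_def by (auto intro!: exI[of _ 0])
  show "geodesic_segment X x y \<subseteq> X \<inter> cball p R"
  proof
    fix z assume "z \<in> geodesic_segment X x y"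
    then obtain c t where c: "geodesic_in X c" "c 0 = x" "c 1 = y" and t: "t \<in> {0..1}" "z = c t"
      by (auto simp: geodesic_segment_def)
    have "dist p z \<le> (1 - t) * dist p x + t * dist p y"
      using dist_geodesics_le[OF X const c(1) t(1)] c t by simp
    also have "\<dots> \<le> (1 - t) * R + t * R"
      using xy t by (intro add_mono mult_left_mono) auto
    also have "\<dots> = R" by (simp add: algebra_simps)
    finally show "z \<in> X \<inter> cball p R"
      using c t unfolding geodesic_in_def by auto
  qed
qed auto

text \<open>
  Moving the endpoints moves the point by at most the interpolated displacement, by convexity of
  the distance between two geodesics; moving the parameter moves it by a multiple of the length of
  the geodesic.
\<close>

lemma continuous_on_geodesic_point:
  assumes X: "convex_metric_space X"
    and cont: "continuous_on S a" "continuous_on S b" "continuous_on S t"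
    and mem: "\<And>s. s \<in> S \<Longrightarrow> a s \<in> X" "\<And>s. s \<in> S \<Longrightarrow> b s \<in> X" "\<And>s. s \<in> S \<Longrightarrow> t s \<in> {0..1}"
  shows "continuous_on S (\<lambda>s. geodesic_point X (a s) (b s) (t s))"
  unfolding continuous_on_def
proof
  fix s assume s: "s \<in> S"
  let ?g = "\<lambda>s. geodesic_point X (a s) (b s) (t s)"
  let ?B = "\<lambda>u. (1 - t u) * dist (a u) (a s) + t u * dist (b u) (b s) + dist (a s) (b s) * \<bar>t u - t s\<bar>"
  have le: "dist (?g u) (?g s) \<le> ?B u" if u: "u \<in> S" for u
  proof -
    have "dist (?g u) (?g s) \<le> dist (?g u) (geodesic_point X (a s) (b s) (t u))
        + dist (geodesic_point X (a s) (b s) (t u)) (?g s)"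
      by (rule dist_triangle)
    moreover have "dist (?g u) (geodesic_point X (a s) (b s) (t u))
        \<le> (1 - t u) * dist (a u) (a s) + t u * dist (b u) (b s)"
      using dist_geodesics_le[OF X geodesic_point(1)[OF X mem(1,2)[OF u]]
          geodesic_point(1)[OF X mem(1,2)[OF s]] mem(3)[OF u]]
      by (simp add: geodesic_point[OF X] mem u s)
    moreover have "dist (geodesic_point X (a s) (b s) (t u)) (?g s) = dist (a s) (b s) * \<bar>t u - t s\<bar>"
      using dist_geodesic_point_same[OF X mem(1,2)[OF s] mem(3)[OF u] mem(3)[OF s]] .
    ultimately show ?thesis by linarith
  qed
  have lims: "(a \<longlongrightarrow> a s) (at s within S)" "(b \<longlongrightarrow> b s) (at s within S)" "(t \<longlongrightarrow> t s) (at s within S)"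
    using cont s unfolding continuous_on_def by auto
  have "(?B \<longlongrightarrow> (1 - t s) * dist (a s) (a s) + t s * dist (b s) (b s) + dist (a s) (b s) * \<bar>t s - t s\<bar>)
      (at s within S)"
    by (intro tendsto_intros lims)
  then have B0: "(?B \<longlongrightarrow> 0) (at s within S)" by simp
  show "(?g \<longlongrightarrow> ?g s) (at s within S)"
    unfolding tendsto_dist_iff[of ?g]
  proof (rule tendsto_sandwich[OF _ _ tendsto_const B0])
    show "\<forall>\<^sub>F u in at s within S. dist (?g u) (?g s) \<le> ?B u"
      unfolding eventually_at_topological using le by blast
  qed simp
qed

lemma convex_metric_space_contractible:
  assumes X: "convex_metric_space X"
  shows "contractible X"
proof -
  obtain p where p: "p \<in> X"
    using X unfolding convex_metric_space_def by blast
  have "continuous_on ({0..1} \<times> X) (\<lambda>z. geodesic_point X (snd z) p (fst z))"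
    by (rule continuous_on_geodesic_point[OF X]) (use p in \<open>auto intro!: continuous_intros\<close>)
  then have "homotopic_with_canon (\<lambda>_. True) X X id (\<lambda>_. p)"
    by (subst homotopic_with, simp)
       (use p in \<open>auto simp: geodesic_point[OF X] geodesic_point_in[OF X]
          intro!: exI[of _ "\<lambda>z. geodesic_point X (snd z) p (fst z)"]\<close>)
  then show ?thesis
    unfolding contractible_def by blast
qed

section \<open>Convex combinations in convex metric spaces\<close>

text \<open>
  A continuous choice of weighted average of the points \<open>p i\<close>. Averages are formed one point
  at a time, since a convex metric space has only binary averages; the result depends on the
  order, but it always stays in every convex set that contains the points with positive weight, and this
  is all that the nerve needs from it. The domain \<open>S\<close> varies in the induction because the
  average of the first points makes sense only where one of their weights is positive.
\<close>

lemma convex_combination_map: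
  fixes w :: "'i \<Rightarrow> 'b::topological_space \<Rightarrow> real"
  assumes X: "convex_metric_space X" and fin: "finite I"
    and cont: "\<And>i. i \<in> I \<Longrightarrow> continuous_on S (w i)"
    and nonneg: "\<And>i x. i \<in> I \<Longrightarrow> x \<in> S \<Longrightarrow> 0 \<le> w i x"
    and pos: "\<And>x. x \<in> S \<Longrightarrow> \<exists>i\<in>I. 0 < w i x"
    and p: "\<And>i. i \<in> I \<Longrightarrow> p i \<in> X"
  shows "\<exists>\<phi>. continuous_on S \<phi> \<and>
    (\<forall>x\<in>S. \<forall>Z. geodesically_convex X Z \<longrightarrow> {p i |i. i \<in> I \<and> 0 < w i x} \<subseteq> Z \<longrightarrow> \<phi> x \<in> Z)"
  using fin cont nonneg pos p
proof (induction I arbitrary: S rule: finite_induct)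
  case empty
  then have "S = {}" by blast
  then show ?case by simp
next
  case (insert k I)
  define W where "W = (\<lambda>x. \<Sum>i\<in>I. w i x)"
  define S' where "S' = {x \<in> S. 0 < W x}"
  have W_cont: "continuous_on S W"
    unfolding W_def using insert.prems(1) by (intro continuous_intros) auto
  have W_nonneg: "0 \<le> W x" if "x \<in> S" for x
    unfolding W_def using that insert.prems(2) by (auto intro: sum_nonneg)
  have W_pos: "0 < W x \<longleftrightarrow> (\<exists>i\<in>I. 0 < w i x)" if "x \<in> S" for x
    using sum_nonneg_eq_0_iff[OF insert.hyps(1), of "\<lambda>i. w i x"] insert.prems(2) that
      W_nonneg[OF that] unfolding W_def by (smt (verit) insertI2)
  have "\<exists>\<phi>. continuous_on S' \<phi> \<and>
    (\<forall>x\<in>S'. \<forall>Z. geodesically_convex X Z \<longrightarrow> {p i |i. i \<in> I \<and> 0 < w i x} \<subseteq> Z \<longrightarrow> \<phi> x \<in> Z)"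
  proof (rule insert.IH)
    show "continuous_on S' (w i)" if "i \<in> I" for i
      using insert.prems(1)[of i] that by (auto simp: S'_def intro: continuous_on_subset)
  qed (use insert.prems W_pos in \<open>auto simp: S'_def\<close>)
  then obtain \<psi> where \<psi>: "continuous_on S' \<psi>"
    "\<And>x Z. x \<in> S' \<Longrightarrow> geodesically_convex X Z \<Longrightarrow> {p i |i. i \<in> I \<and> 0 < w i x} \<subseteq> Z \<Longrightarrow> \<psi> x \<in> Z"
    by blast
  have k: "p k \<in> X" "continuous_on S (w k)" "\<And>x. x \<in> S \<Longrightarrow> 0 \<le> w k x"
    using insert.prems by auto
  \<comment> \<open>The partial averages stay in a fixed ball: they do so because balls are convex. This controls
    them near points where all weights so far vanish.\<close>
  define R where "R = (\<Sum>i\<in>I. dist (p k) (p i))"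
  have "dist (p k) (p i) \<le> R" if "i \<in> I" for i
    unfolding R_def by (rule member_le_sum) (use that insert.hyps in auto)
  then have "{p i |i. i \<in> I \<and> 0 < w i x} \<subseteq> X \<inter> cball (p k) R" for x
    using insert.prems(4) by auto
  then have \<psi>_ball: "\<psi> x \<in> X \<inter> cball (p k) R" if "x \<in> S'" for x
    using \<psi>(2)[OF that geodesically_convex_cball[OF X k(1)]] by blast
  have den: "0 < W x + w k x" if "x \<in> S" for x
    using insert.prems(3)[OF that] W_pos[OF that] W_nonneg[OF that] k(3)[OF that]
    by (auto intro: add_pos_nonneg add_nonneg_pos)
  define t where "t = (\<lambda>x. w k x / (W x + w k x))"
  have t01: "t x \<in> {0..1}" if "x \<in> S" for x
    using den[OF that] W_nonneg[OF that] k(3)[OF that] by (auto simp: t_def)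
  have t_cont: "continuous_on S t"
    unfolding t_def using den by (intro continuous_intros W_cont k(2)) force
  define \<phi> where "\<phi> = (\<lambda>x. if 0 < W x then geodesic_point X (\<psi> x) (p k) (t x) else p k)"
  have "continuous_on S \<phi>"
    unfolding continuous_on_def
  proof
    fix x assume x: "x \<in> S"
    show "(\<phi> \<longlongrightarrow> \<phi> x) (at x within S)"
    proof (cases "0 < W x")
      case True
      have "continuous_on S' (\<lambda>x. geodesic_point X (\<psi> x) (p k) (t x))"
        by (rule continuous_on_geodesic_point[OF X \<psi>(1)])
           (use \<psi>_ball k t01 in \<open>auto simp: S'_def intro: continuous_on_subset[OF t_cont]\<close>)
      then have "continuous_on S' \<phi>"
        by (rule continuous_on_eq) (simp add: \<phi>_def S'_def)
      then have "(\<phi> \<longlongrightarrow> \<phi> x) (at x within S')"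
        using True x by (auto simp: continuous_on_def S'_def)
      moreover have "openin (top_of_set S) S'"
      proof -
        have "S' = S \<inter> W -` {0<..}" by (auto simp: S'_def)
        then show ?thesis
          using continuous_openin_preimage_gen[OF W_cont, of "{0<..}"] by simp
      qed
      then obtain U where "open U" "S' = S \<inter> U"
        by (auto simp: openin_open)
      then have "at x within S = at x within S'"
        using True x by (intro at_within_nhd[of _ U]) (auto simp: S'_def)
      ultimately show ?thesis by simp
    next
      case False
      with W_nonneg[OF x] have W0: "W x = 0" by simp
      have "(t \<longlongrightarrow> t x) (at x within S)"
        using t_cont x by (auto simp: continuous_on_def)
      moreover have "t x = 1"
        using den[OF x] W0 by (simp add: t_def)
      ultimately have "((\<lambda>u. (1 - t u) * R) \<longlongrightarrow> (1 - 1) * R) (at x within S)"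
        by (intro tendsto_intros) simp
      then have lim: "((\<lambda>u. (1 - t u) * R) \<longlongrightarrow> 0) (at x within S)" by simp
      \<comment> \<open>Here \<open>\<psi>\<close> may oscillate near \<open>x\<close>, but only within the ball of radius
        \<open>R\<close>, while \<open>t\<close> tends to 1.\<close>
      have "dist (\<phi> u) (\<phi> x) \<le> (1 - t u) * R" if u: "u \<in> S" for u
      proof (cases "0 < W u")
        case True
        then have b: "\<psi> u \<in> X" "dist (p k) (\<psi> u) \<le> R"
          using \<psi>_ball[of u] u by (auto simp: S'_def)
        have "dist (geodesic_point X (\<psi> u) (p k) (t u)) (geodesic_point X (\<psi> u) (p k) 1)
            = dist (\<psi> u) (p k) * \<bar>t u - 1\<bar>"
          by (rule dist_geodesic_point_same[OF X b(1) k(1) t01[OF u]]) simp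
        also have "\<dots> = dist (p k) (\<psi> u) * (1 - t u)"
          using t01[OF u] by (simp add: dist_commute)
        also have "\<dots> \<le> R * (1 - t u)"
          using b(2) t01[OF u] by (intro mult_right_mono) auto
        finally show ?thesis
          using True False geodesic_point(3)[OF X b(1) k(1)] by (simp add: \<phi>_def mult.commute)
      next
        case 2: False
        have "0 \<le> R" by (simp add: R_def sum_nonneg)
        then show ?thesis using 2 False t01[OF u] by (simp add: \<phi>_def)
      qed
      then show ?thesis
        unfolding tendsto_dist_iff[of \<phi>]
        by (intro tendsto_sandwich[OF _ _ tendsto_const lim])
           (auto simp: eventually_at_topological)
    qed
  qed
  moreover have "\<phi> x \<in> Z"
    if x: "x \<in> S" and Z: "geodesically_convex X Z"
      and sub: "{p i |i. i \<in> insert k I \<and> 0 < w i x} \<subseteq> Z" for x Z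
  proof (cases "0 < W x")
    case True
    then have "x \<in> S'" using x by (simp add: S'_def)
    then have \<psi>Z: "\<psi> x \<in> Z" using \<psi>(2)[OF _ Z] sub by auto
    have \<psi>X: "\<psi> x \<in> X" using \<psi>_ball[OF \<open>x \<in> S'\<close>] by simp
    show ?thesis
    proof (cases "0 < w k x")
      case pos: True
      then have "p k \<in> Z" using sub by auto
      then show ?thesis
        using True geodesic_point_in_convex[OF X Z \<psi>Z _ t01[OF x]] by (simp add: \<phi>_def)
    next
      case zero: False
      then have "t x = 0" using k(3)[OF x] by (simp add: t_def)
      then show ?thesis
        using True \<psi>Z geodesic_point(2)[OF X \<psi>X k(1)] by (simp add: \<phi>_def)
    qed
  next
    case False
    then have "0 < w k x" using den[OF x] W_nonneg[OF x] by linarith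
    then show ?thesis using sub False by (auto simp: \<phi>_def)
  qed
  ultimately show ?case by blast
qed

section \<open>Maps into geometric realizations\<close>

definition realization_points :: "'v set set \<Rightarrow> ('v \<Rightarrow> real) set" where
  "realization_points K =
     {x. (\<forall>v. 0 \<le> x v) \<and> {v. x v \<noteq> 0} \<in> K \<and> (\<Sum>v | x v \<noteq> 0. x v) = 1}"

lemma geometric_realization_eq: "geometric_realization K = top_of_set (realization_points K)"
  unfolding geometric_realization_def realization_points_def
  by (simp add: euclidean_product_topology)

text \<open>
  Strictly between its ends, the segment from \<open>g x\<close> to \<open>h x\<close> has the union of both
  supports as its support, so it stays in the realization as soon as this union is a simplex.
\<close>

lemma homotopic_straight_line:
  fixes g h :: "'b::topological_space \<Rightarrow> 'v \<Rightarrow> real"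
  assumes K: "\<And>\<sigma>. \<sigma> \<in> K \<Longrightarrow> finite \<sigma>"
    and cont: "continuous_on S g" "continuous_on S h"
    and g: "\<And>x. x \<in> S \<Longrightarrow> g x \<in> realization_points K"
    and h: "\<And>x. x \<in> S \<Longrightarrow> h x \<in> realization_points K"
    and carrier: "\<And>x. x \<in> S \<Longrightarrow> {v. g x v \<noteq> 0} \<union> {v. h x v \<noteq> 0} \<in> K"
  shows "homotopic_with (\<lambda>_. True) (top_of_set S) (geometric_realization K) g h"
proof -
  define H where "H = (\<lambda>z v. (1 - fst z) * g (snd z) v + fst z * h (snd z) v)"
  have snd: "continuous_on ({0..1::real} \<times> S) (\<lambda>z. k (snd z) v)"
    if "continuous_on S k" for k :: "'b \<Rightarrow> 'v \<Rightarrow> real" and v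
    by (rule continuous_on_compose2[OF continuous_on_product_then_coordinatewise[OF that]
          continuous_on_snd[OF continuous_on_id]]) auto
  have H_cont: "continuous_on ({0..1} \<times> S) H"
    unfolding H_def
    by (intro continuous_on_coordinatewise_then_product continuous_on_add continuous_on_mult
        continuous_on_diff continuous_on_const continuous_on_fst continuous_on_id snd cont)
  have H_in: "H (t, x) \<in> realization_points K" if t: "t \<in> {0..1}" and x: "x \<in> S" for t x
  proof -
    define U where "U = {v. g x v \<noteq> 0} \<union> {v. h x v \<noteq> 0}"
    have U: "finite U" "U \<in> K" using carrier[OF x] K by (auto simp: U_def)
    have nn: "0 \<le> g x v" "0 \<le> h x v" for v
      using g[OF x] h[OF x] by (auto simp: realization_points_def)
    have sum_U: "(\<Sum>v\<in>U. k v) = 1"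
      if "k \<in> realization_points K" "{v. k v \<noteq> 0} \<subseteq> U" for k
    proof -
      have "(\<Sum>v\<in>U. k v) = (\<Sum>v | k v \<noteq> 0. k v)"
        by (rule sum.mono_neutral_right) (use U that(2) in auto)
      then show ?thesis using that(1) by (simp add: realization_points_def)
    qed
    have sg: "(\<Sum>v\<in>U. g x v) = 1" and sh: "(\<Sum>v\<in>U. h x v) = 1"
      by (rule sum_U[OF g[OF x]] sum_U[OF h[OF x]], simp add: U_def)+
    have Hnn: "0 \<le> H (t, x) v" for v
      using nn t by (auto simp: H_def)
    have "{v. H (t, x) v \<noteq> 0} \<subseteq> U"
      by (auto simp: H_def U_def)
    then have "(\<Sum>v | H (t, x) v \<noteq> 0. H (t, x) v) = (\<Sum>v\<in>U. H (t, x) v)"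
      by (intro sum.mono_neutral_left U) auto
    also have "\<dots> = 1"
      by (simp add: H_def sum.distrib sg sh flip: sum_distrib_left)
    finally have sum: "(\<Sum>v | H (t, x) v \<noteq> 0. H (t, x) v) = 1" .
    consider "t = 0" | "t = 1" | "0 < t" "t < 1" using t by force
    then have "{v. H (t, x) v \<noteq> 0} \<in> K"
    proof cases
      case 1
      then show ?thesis using g[OF x] by (simp add: H_def realization_points_def)
    next
      case 2
      then show ?thesis using h[OF x] by (simp add: H_def realization_points_def)
    next
      case 3
      then have "H (t, x) v = 0 \<longleftrightarrow> g x v = 0 \<and> h x v = 0" for v
        using nn[of v] by (auto simp: H_def add_nonneg_eq_0_iff)
      then have "{v. H (t, x) v \<noteq> 0} = U" by (auto simp: U_def)
      then show ?thesis using U by simp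
    qed
    then show ?thesis using Hnn sum by (simp add: realization_points_def)
  qed
  show ?thesis
    unfolding homotopic_with_def geometric_realization_eq
    using H_cont H_in by (intro exI[of _ H]) (auto simp: H_def)
qed

definition normalize_weights :: "'v set \<Rightarrow> ('v \<Rightarrow> 'b \<Rightarrow> real) \<Rightarrow> 'b \<Rightarrow> 'v \<Rightarrow> real" where
  "normalize_weights V u x v = (if v \<in> V then u v x / (\<Sum>w\<in>V. u w x) else 0)"

lemma normalize_weights:
  fixes u :: "'v \<Rightarrow> 'b::topological_space \<Rightarrow> real"
  assumes V: "finite V"
    and cont': "\<forall>v\<in>V. continuous_on S (u v)"
    and nonneg': "\<forall>x\<in>S. \<forall>v\<in>V. 0 \<le> u v x"
    and pos': "\<forall>x\<in>S. \<exists>v\<in>V. 0 < u v x"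
  shows "continuous_on S (normalize_weights V u)"
    and "x \<in> S \<Longrightarrow> {v. normalize_weights V u x v \<noteq> 0} = {v \<in> V. 0 < u v x}"
    and "x \<in> S \<Longrightarrow> {v \<in> V. 0 < u v x} \<in> K \<Longrightarrow> normalize_weights V u x \<in> realization_points K"
proof -
  have cont: "\<And>v. v \<in> V \<Longrightarrow> continuous_on S (u v)"
    and nonneg: "\<And>v x. v \<in> V \<Longrightarrow> x \<in> S \<Longrightarrow> 0 \<le> u v x"
    and pos: "\<And>x. x \<in> S \<Longrightarrow> \<exists>v\<in>V. 0 < u v x"
    using cont' nonneg' pos' by auto
  have den: "0 < (\<Sum>w\<in>V. u w x)" if x: "x \<in> S" for x
    using pos[OF x] sum_pos2[OF V, of _ "\<lambda>w. u w x"] nonneg[OF _ x] by blast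
  have "continuous_on S (\<lambda>x. u v x / (\<Sum>w\<in>V. u w x))" if "v \<in> V" for v
    using den by (intro continuous_on_divide continuous_on_sum cont that) force+
  then have "continuous_on S (\<lambda>x. normalize_weights V u x v)" for v
    unfolding normalize_weights_def by (cases "v \<in> V") simp_all
  then show "continuous_on S (normalize_weights V u)"
    by (rule continuous_on_coordinatewise_then_product)
  show supp: "{v. normalize_weights V u x v \<noteq> 0} = {v \<in> V. 0 < u v x}" if x: "x \<in> S" for x
    using den[OF x] nonneg[OF _ x] by (auto simp: normalize_weights_def less_le)
  assume x: "x \<in> S" and mem: "{v \<in> V. 0 < u v x} \<in> K"
  have "(\<Sum>v | normalize_weights V u x v \<noteq> 0. normalize_weights V u x v)
      = (\<Sum>v\<in>V. normalize_weights V u x v)"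
    by (rule sum.mono_neutral_left) (use V in \<open>auto simp: normalize_weights_def\<close>)
  also have "\<dots> = (\<Sum>v\<in>V. u v x / (\<Sum>w\<in>V. u w x))"
    by (rule sum.cong) (auto simp: normalize_weights_def)
  also have "\<dots> = 1"
    using den[OF x] by (simp flip: sum_divide_distrib)
  finally show "normalize_weights V u x \<in> realization_points K"
    using mem supp[OF x] den[OF x] nonneg[OF _ x]
    by (auto simp: realization_points_def normalize_weights_def intro!: divide_nonneg_pos)
qed

section \<open>Swelling closed sets without changing their nerve\<close>

lemma finite_maximizer:
  fixes f :: "'i \<Rightarrow> 'c::linorder"
  assumes "finite A" "A \<noteq> {}"
  shows "\<exists>a\<in>A. \<forall>b\<in>A. f b \<le> f a"
proof -
  have "Max (f ` A) \<in> f ` A"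
    using assms by simp
  then obtain a where a: "a \<in> A" "Max (f ` A) = f a" by (rule imageE)
  have "f b \<le> f a" if "b \<in> A" for b
    unfolding a(2)[symmetric] using assms(1) that by simp
  with a(1) show ?thesis by blast
qed

text \<open>
  The factor for a subfamily \<open>\<sigma>\<close> with empty intersection is positive exactly where the
  distance to \<open>C\<close> is below the average of the distances to the members of \<open>\<sigma>\<close>. This cannot
  hold for all members of \<open>\<sigma>\<close> at the same point, but it does hold on \<open>C\<close>, where the
  distance to \<open>C\<close> is 0 and that to another member is not. The empty set is treated apart because
  \<open>infdist x {} = 0\<close> would make it look like a set containing every point.
\<close>

definition swelling_weight :: "'a::metric_space set set \<Rightarrow> 'a set \<Rightarrow> 'a \<Rightarrow> real" where
  "swelling_weight \<C> C x = (if C = {} then 0 else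
     \<Prod>\<sigma> | \<sigma> \<subseteq> \<C> - {{}} \<and> C \<in> \<sigma> \<and> \<Inter>\<sigma> = {}. max 0 (\<Sum>D\<in>\<sigma>. infdist x D - infdist x C))"

lemma continuous_on_swelling_weight: "continuous_on S (swelling_weight \<C> C)"
proof -
  have "continuous_on S (\<lambda>x. \<Prod>\<sigma> | \<sigma> \<subseteq> \<C> - {{}} \<and> C \<in> \<sigma> \<and> \<Inter>\<sigma> = {}.
      max 0 (\<Sum>D\<in>\<sigma>. infdist x D - infdist x C))"
    by (intro continuous_intros)
  then show ?thesis
    by (cases "C = {}") (simp_all add: swelling_weight_def[abs_def])
qed

lemma swelling_weight_nonneg: "0 \<le> swelling_weight \<C> C x"
  by (auto simp: swelling_weight_def intro: prod_nonneg)

lemma swelling_weight_pos: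
  fixes X :: "'a::metric_space set"
  assumes fin: "finite \<C>" and closed: "\<And>C. C \<in> \<C> \<Longrightarrow> closedin (top_of_set X) C"
    and C: "C \<in> \<C>" and x: "x \<in> C"
  shows "0 < swelling_weight \<C> C x"
proof -
  have xX: "x \<in> X" using closedin_subset[OF closed[OF C]] x by auto
  have "0 < max 0 (\<Sum>D\<in>\<sigma>. infdist x D - infdist x C)"
    if \<sigma>: "\<sigma> \<in> {\<sigma>. \<sigma> \<subseteq> \<C> - {{}} \<and> C \<in> \<sigma> \<and> \<Inter>\<sigma> = {}}" for \<sigma>
  proof -
    obtain D where D: "D \<in> \<sigma>" "x \<notin> D" using \<sigma> by auto
    then have D': "D \<in> \<C>" "D \<noteq> {}" using \<sigma> by auto
    obtain T where T: "closed T" "D = X \<inter> T"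
      using closed[OF D'(1)] by (auto simp: closedin_closed)
    then have "closure D \<subseteq> T" by (simp add: closure_minimal)
    then have "x \<notin> closure D" using D(2) T xX by blast
    then have "0 < infdist x D"
      using in_closure_iff_infdist_zero[OF D'(2), of x] infdist_nonneg[of x D] by linarith
    moreover have "finite \<sigma>" using \<sigma> fin finite_subset[of \<sigma> \<C>] by auto
    ultimately have "0 < (\<Sum>D\<in>\<sigma>. infdist x D)"
      using D(1) by (intro sum_pos2[of _ D]) (auto simp: infdist_nonneg)
    then show ?thesis using x by simp
  qed
  then have "0 < (\<Prod>\<sigma> | \<sigma> \<subseteq> \<C> - {{}} \<and> C \<in> \<sigma> \<and> \<Inter>\<sigma> = {}.
      max 0 (\<Sum>D\<in>\<sigma>. infdist x D - infdist x C))"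
    by (rule prod_pos)
  moreover have "C \<noteq> {}" using x by blast
  ultimately show ?thesis by (simp add: swelling_weight_def)
qed

text \<open>
  If \<open>\<Inter>\<sigma>\<close> were empty, then \<open>\<sigma>\<close> would contribute a factor to the weight of
  its member farthest from \<open>x\<close>; that factor vanishes, as the largest distance is not below
  the average.
\<close>

lemma Inter_nonempty_if_swelling_weights_pos:
  assumes fin: "finite \<C>" and \<sigma>: "\<sigma> \<subseteq> \<C>" "\<sigma> \<noteq> {}"
    and pos: "\<And>C. C \<in> \<sigma> \<Longrightarrow> 0 < swelling_weight \<C> C x"
  shows "\<Inter>\<sigma> \<noteq> {}"
proof
  assume empty: "\<Inter>\<sigma> = {}"
  have "{} \<notin> \<sigma>" using pos[of "{}"] by (auto simp: swelling_weight_def)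
  have "finite \<sigma>" using \<sigma>(1) fin by (rule finite_subset)
  then obtain C where C: "C \<in> \<sigma>" and max: "\<forall>D\<in>\<sigma>. infdist x D \<le> infdist x C"
    using finite_maximizer[OF _ \<sigma>(2), of "infdist x"] by blast
  have "(\<Sum>D\<in>\<sigma>. infdist x D - infdist x C) \<le> 0"
    using max by (intro sum_nonpos) simp
  then have "\<exists>\<tau>\<in>{\<sigma>. \<sigma> \<subseteq> \<C> - {{}} \<and> C \<in> \<sigma> \<and> \<Inter>\<sigma> = {}}.
      max 0 (\<Sum>D\<in>\<tau>. infdist x D - infdist x C) = 0"
    using \<sigma> C empty \<open>{} \<notin> \<sigma>\<close> by (intro bexI[of _ \<sigma>]) auto
  moreover have "finite {\<sigma>. \<sigma> \<subseteq> \<C> - {{}} \<and> C \<in> \<sigma> \<and> \<Inter>\<sigma> = {}}"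
    by (rule finite_subset[of _ "Pow \<C>"]) (use fin in auto)
  ultimately have "(\<Prod>\<sigma> | \<sigma> \<subseteq> \<C> - {{}} \<and> C \<in> \<sigma> \<and> \<Inter>\<sigma> = {}.
      max 0 (\<Sum>D\<in>\<sigma>. infdist x D - infdist x C)) = 0"
    by (intro prod_zero)
  then show False using pos[OF C] by (auto simp: swelling_weight_def split: if_splits)
qed

section \<open>The nerve as a homotopy retract of the union\<close>

lemma nerve_complex_subset:
  assumes "\<tau> \<in> nerve_complex \<C>" "\<sigma> \<subseteq> \<tau>" "\<sigma> \<noteq> {}"
  shows "\<sigma> \<in> nerve_complex \<C>"
proof -
  have "finite \<sigma>" using assms(1,2) finite_subset by (auto simp: nerve_complex_def)
  moreover have "\<Inter>\<tau> \<subseteq> \<Inter>\<sigma>" using assms(2) by (rule Inter_anti_mono)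
  ultimately show ?thesis
    using assms by (auto simp: nerve_complex_def)
qed

text \<open>
  The weights of the convex combination mimic barycentric coordinates of the first subdivision: the
  weight of \<open>\<sigma>\<close> is positive iff \<open>\<sigma>\<close> is a strict superlevel set of the
  coordinates of \<open>x\<close>. All such \<open>\<sigma>\<close> contain each \<open>C\<close> of maximal
  coordinate, so all points being averaged lie in the convex set \<open>C\<close>.
\<close>

lemma nerve_to_union_map:
  fixes X :: "'a::metric_space set"
  assumes X: "convex_metric_space X" and fin: "finite \<C>"
    and conv: "\<And>C. C \<in> \<C> \<Longrightarrow> geodesically_convex X C"
  shows "\<exists>\<phi>. continuous_on (realization_points (nerve_complex \<C>)) \<phi> \<and>
    (\<forall>x \<in> realization_points (nerve_complex \<C>). \<exists>C\<in>\<C>. 0 < x C \<and> \<phi> x \<in> C)"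
proof -
  let ?K = "nerve_complex \<C>" and ?N = "realization_points (nerve_complex \<C>)"
  define w where "w = (\<lambda>\<sigma> (x :: 'a set \<Rightarrow> real). \<Prod>C\<in>\<sigma>. \<Prod>D\<in>\<C> - \<sigma>. max 0 (x C - x D))"
  have coord: "continuous_on ?N (\<lambda>x. x C)" for C
    by (rule continuous_on_subset[OF continuous_on_product_coordinates]) simp
  have finK: "finite ?K"
    by (rule finite_subset[of _ "Pow \<C>"]) (use fin in \<open>auto simp: nerve_complex_def\<close>)
  have top: "\<exists>C\<in>\<C>. 0 < x C \<and> (\<forall>D\<in>\<C>. x D \<le> x C)" if x: "x \<in> ?N" for x
  proof -
    have supp: "{C. x C \<noteq> 0} \<in> ?K" using x by (simp add: realization_points_def)
    then obtain D where D: "x D \<noteq> 0" "D \<in> \<C>"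
      by (auto simp: nerve_complex_def)
    then have "\<C> \<noteq> {}" by blast
    then obtain C where C: "C \<in> \<C>" "\<forall>D\<in>\<C>. x D \<le> x C"
      using finite_maximizer[OF fin] by metis
    have "0 \<le> x D" using x by (simp add: realization_points_def)
    with D(1) have "0 < x D" by simp
    also have "x D \<le> x C" using C(2) D(2) by blast
    finally show ?thesis using C by blast
  qed
  have w_superlevel: "C \<in> \<sigma>"
    if x: "x \<in> ?N" and C: "C \<in> \<C>" "\<forall>D\<in>\<C>. x D \<le> x C" and \<sigma>: "\<sigma> \<in> ?K" "0 < w \<sigma> x" for x C \<sigma>
  proof (rule ccontr)
    assume notin: "C \<notin> \<sigma>"
    obtain D where D: "D \<in> \<sigma>" "D \<in> \<C>" "finite \<sigma>" using \<sigma> by (auto simp: nerve_complex_def)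
    have "(\<Prod>E\<in>\<C> - \<sigma>. max 0 (x D - x E)) = 0"
      using notin C D fin by (auto intro!: bexI[of _ C])
    then have "w \<sigma> x = 0" using D by (auto simp: w_def)
    with \<sigma> show False by simp
  qed
  have w_pos: "\<exists>\<sigma>\<in>?K. 0 < w \<sigma> x" if x: "x \<in> ?N" for x
  proof -
    obtain C where C: "C \<in> \<C>" "0 < x C" "\<forall>D\<in>\<C>. x D \<le> x C" using top[OF x] by blast
    \<comment> \<open>The vertices of maximal coordinate always form a superlevel set.\<close>
    define \<sigma> where "\<sigma> = {D \<in> \<C>. x D = x C}"
    have "\<sigma> \<subseteq> {C. x C \<noteq> 0}" "\<sigma> \<noteq> {}" using C by (auto simp: \<sigma>_def)
    moreover have "{C. x C \<noteq> 0} \<in> ?K" using x by (simp add: realization_points_def)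
    ultimately have "\<sigma> \<in> ?K"
      using nerve_complex_subset by metis
    have "0 < (\<Prod>E\<in>\<C> - \<sigma>. max 0 (x D - x E))" if "D \<in> \<sigma>" for D
    proof (rule prod_pos)
      fix E assume "E \<in> \<C> - \<sigma>"
      then have "x E \<noteq> x C" "x E \<le> x C" using C(3) by (auto simp: \<sigma>_def)
      then show "0 < max 0 (x D - x E)" using that by (simp add: \<sigma>_def)
    qed
    then have "0 < w \<sigma> x"
      unfolding w_def by (rule prod_pos)
    with \<open>\<sigma> \<in> ?K\<close> show ?thesis by blast
  qed
  define p where "p = (\<lambda>\<sigma> :: 'a set set. SOME q. q \<in> \<Inter>\<sigma>)"
  have p: "p \<sigma> \<in> \<Inter>\<sigma>" if "\<sigma> \<in> ?K" for \<sigma>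
    unfolding p_def by (rule someI_ex) (use that in \<open>auto simp: nerve_complex_def\<close>)
  have pX: "p \<sigma> \<in> X" if \<sigma>: "\<sigma> \<in> ?K" for \<sigma>
  proof -
    obtain C where "C \<in> \<sigma>" "C \<in> \<C>" using \<sigma> by (auto simp: nerve_complex_def)
    then show ?thesis using p[OF \<sigma>] conv[of C] by (auto simp: geodesically_convex_def)
  qed
  have "\<exists>\<phi>. continuous_on ?N \<phi> \<and>
    (\<forall>x\<in>?N. \<forall>Z. geodesically_convex X Z \<longrightarrow> {p \<sigma> |\<sigma>. \<sigma> \<in> ?K \<and> 0 < w \<sigma> x} \<subseteq> Z \<longrightarrow> \<phi> x \<in> Z)"
  proof (rule convex_combination_map[OF X finK _ _ w_pos pX])
    show "continuous_on ?N (w \<sigma>)" for \<sigma>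
      unfolding w_def by (intro continuous_intros coord)
    show "0 \<le> w \<sigma> x" if "x \<in> ?N" for \<sigma> x
      unfolding w_def by (intro prod_nonneg) simp
  qed
  then obtain \<phi> where \<phi>: "continuous_on ?N \<phi>"
    "\<And>x Z. x \<in> ?N \<Longrightarrow> geodesically_convex X Z \<Longrightarrow> {p \<sigma> |\<sigma>. \<sigma> \<in> ?K \<and> 0 < w \<sigma> x} \<subseteq> Z \<Longrightarrow> \<phi> x \<in> Z"
    by blast
  have "\<exists>C\<in>\<C>. 0 < x C \<and> \<phi> x \<in> C" if x: "x \<in> ?N" for x
  proof -
    obtain C where C: "C \<in> \<C>" "0 < x C" "\<forall>D\<in>\<C>. x D \<le> x C" using top[OF x] by blast
    have "{p \<sigma> |\<sigma>. \<sigma> \<in> ?K \<and> 0 < w \<sigma> x} \<subseteq> C"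
      using w_superlevel[OF x C(1,3)] p by blast
    then have "\<phi> x \<in> C" by (rule \<phi>(2)[OF x conv[OF C(1)]])
    with C show ?thesis by blast
  qed
  then show ?thesis using \<phi>(1) by blast
qed

text \<open>
  The intermediate map \<open>\<mu>\<close> of the proof is supported where \<open>x\<close> and
  \<open>\<psi> (\<phi> x)\<close> both are. This common support is non-empty because
  \<open>\<phi> x\<close> lies in a member of \<open>\<C>\<close> whose coordinate at \<open>x\<close> is positive.
\<close>

lemma nerve_homotopy_retract:
  fixes X :: "'a::metric_space set"
  assumes X: "convex_metric_space X" and fin: "finite \<C>"
    and \<C>: "\<And>C. C \<in> \<C> \<Longrightarrow> closedin (top_of_set X) C \<and> geodesically_convex X C"
  obtains \<phi> \<psi> where "continuous_map (nerve \<C>) (top_of_set (\<Union>\<C>)) \<phi>"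
    "continuous_map (top_of_set (\<Union>\<C>)) (nerve \<C>) \<psi>"
    "homotopic_with (\<lambda>_. True) (nerve \<C>) (nerve \<C>) id (\<psi> \<circ> \<phi>)"
proof -
  let ?K = "nerve_complex \<C>"
  let ?N = "realization_points ?K"
  have nerve: "nerve \<C> = top_of_set ?N"
    by (simp add: nerve_def geometric_realization_eq)
  have closed: "closedin (top_of_set X) C" and conv: "geodesically_convex X C" if "C \<in> \<C>" for C
    using \<C>[OF that] by auto
  have "\<exists>\<phi>. continuous_on ?N \<phi> \<and> (\<forall>x\<in>?N. \<exists>C\<in>\<C>. 0 < x C \<and> \<phi> x \<in> C)"
    using X fin conv by (rule nerve_to_union_map)
  then obtain \<phi> where \<phi>': "continuous_on ?N \<phi>"
    "\<forall>x\<in>?N. \<exists>C\<in>\<C>. 0 < x C \<and> \<phi> x \<in> C"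
    by blast
  note \<phi> = \<phi>'(1) bspec[OF \<phi>'(2)]
  define u where "u = swelling_weight \<C>"
  have u_nn: "0 \<le> u C y" for C y
    unfolding u_def by (rule swelling_weight_nonneg)
  have u_pos: "0 < u C y" if "C \<in> \<C>" "y \<in> C" for C y
    unfolding u_def using fin closed that by (rule swelling_weight_pos)
  have u_cont: "continuous_on (\<Union>\<C>) (u C)" for C
    unfolding u_def by (rule continuous_on_swelling_weight)
  have u_simplex: "{C \<in> \<C>. 0 < u C y} \<in> ?K" if "y \<in> \<Union>\<C>" for y
  proof -
    have ne: "{C \<in> \<C>. 0 < u C y} \<noteq> {}" using that u_pos by blast
    have "\<Inter>{C \<in> \<C>. 0 < u C y} \<noteq> {}"
      by (rule Inter_nonempty_if_swelling_weights_pos[OF fin _ ne, of y]) (auto simp: u_def)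
    with ne fin show ?thesis by (simp add: nerve_complex_def)
  qed
  define \<psi> where "\<psi> = normalize_weights \<C> u"
  have "\<forall>C\<in>\<C>. continuous_on (\<Union>\<C>) (u C)" "\<forall>y\<in>\<Union>\<C>. \<forall>C\<in>\<C>. 0 \<le> u C y"
    "\<forall>y\<in>\<Union>\<C>. \<exists>C\<in>\<C>. 0 < u C y"
    using u_cont u_nn by (blast, blast, blast intro: u_pos)
  note \<psi>N = normalize_weights[OF fin this, folded \<psi>_def]
  have \<psi>: "continuous_on (\<Union>\<C>) \<psi>"
    "\<And>y. y \<in> \<Union>\<C> \<Longrightarrow> {C. \<psi> y C \<noteq> 0} = {C \<in> \<C>. 0 < u C y}"
    "\<And>y. y \<in> \<Union>\<C> \<Longrightarrow> \<psi> y \<in> ?N"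
    by (rule \<psi>N(1), rule \<psi>N(2), assumption, rule \<psi>N(3), assumption, rule u_simplex)
  have \<phi>U: "\<phi> x \<in> \<Union>\<C>" if "x \<in> ?N" for x using \<phi>(2)[OF that] by blast
  have nn: "0 \<le> x C" if "x \<in> ?N" for x C
    using that by (simp add: realization_points_def)
  have suppK: "{C. x C \<noteq> 0} \<in> ?K" if "x \<in> ?N" for x
    using that by (simp add: realization_points_def)
  define m where "m = (\<lambda>C x. x C * u C (\<phi> x))"
  have m_supp: "{C \<in> \<C>. 0 < m C x} = {C \<in> \<C>. x C \<noteq> 0 \<and> 0 < u C (\<phi> x)}" if x: "x \<in> ?N" for x
  proof -
    have "0 < m C x \<longleftrightarrow> x C \<noteq> 0 \<and> 0 < u C (\<phi> x)" for C
      unfolding m_def zero_less_mult_iff using nn[OF x, of C] by linarith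
    then show ?thesis by simp
  qed
  have m_ex: "\<exists>C\<in>\<C>. 0 < m C x" if x: "x \<in> ?N" for x
    unfolding m_def using \<phi>(2)[OF x] u_pos mult_pos_pos by metis
  have m_simplex: "{C \<in> \<C>. 0 < m C x} \<in> ?K" if x: "x \<in> ?N" for x
  proof (rule nerve_complex_subset[OF suppK[OF x]])
    show "{C \<in> \<C>. 0 < m C x} \<subseteq> {C. x C \<noteq> 0}" using m_supp[OF x] by blast
    show "{C \<in> \<C>. 0 < m C x} \<noteq> {}" using m_ex[OF x] by blast
  qed
  have m_cont: "continuous_on ?N (m C)" for C
  proof -
    have "continuous_on ?N (\<lambda>x. x C)"
      by (rule continuous_on_subset[OF continuous_on_product_coordinates]) simp
    moreover have "continuous_on ?N (\<lambda>x. u C (\<phi> x))"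
      by (rule continuous_on_compose2[OF u_cont \<phi>(1)]) (use \<phi>U in auto)
    ultimately show ?thesis unfolding m_def by (intro continuous_intros)
  qed
  have m_nn: "0 \<le> m C x" if "x \<in> ?N" for C x
    using nn[OF that] u_nn by (simp add: m_def)
  define \<mu> where "\<mu> = normalize_weights \<C> m"
  have "\<forall>C\<in>\<C>. continuous_on ?N (m C)" "\<forall>x\<in>?N. \<forall>C\<in>\<C>. 0 \<le> m C x"
    "\<forall>x\<in>?N. \<exists>C\<in>\<C>. 0 < m C x"
    using m_cont m_nn m_ex by auto
  note \<mu>N = normalize_weights[OF fin this, folded \<mu>_def]
  have \<mu>: "continuous_on ?N \<mu>" "\<And>x. x \<in> ?N \<Longrightarrow> \<mu> x \<in> ?N"
    "\<And>x. x \<in> ?N \<Longrightarrow> {C. \<mu> x C \<noteq> 0} = {C \<in> \<C>. x C \<noteq> 0 \<and> 0 < u C (\<phi> x)}"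
    by (rule \<mu>N(1), rule \<mu>N(3), assumption, rule m_simplex) (simp_all add: \<mu>N(2) m_supp)
  have finK: "finite \<sigma>" if "\<sigma> \<in> ?K" for \<sigma> using that by (simp add: nerve_complex_def)
  have "homotopic_with (\<lambda>_. True) (top_of_set ?N) (geometric_realization ?K) id \<mu>"
  proof (rule homotopic_straight_line[OF finK])
    fix x assume x: "x \<in> ?N"
    have "{C. id x C \<noteq> 0} \<union> {C. \<mu> x C \<noteq> 0} = {C. x C \<noteq> 0}" using \<mu>(3)[OF x] by auto
    then show "{C. id x C \<noteq> 0} \<union> {C. \<mu> x C \<noteq> 0} \<in> ?K" using suppK[OF x] by simp
  qed (use \<mu> in \<open>auto intro: continuous_on_id\<close>)
  moreover have "homotopic_with (\<lambda>_. True) (top_of_set ?N) (geometric_realization ?K) \<mu> (\<psi> \<circ> \<phi>)"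
  proof (rule homotopic_straight_line[OF finK])
    show "continuous_on ?N (\<psi> \<circ> \<phi>)"
      by (rule continuous_on_compose[OF \<phi>(1) continuous_on_subset[OF \<psi>(1)]]) (use \<phi>U in auto)
    fix x assume x: "x \<in> ?N"
    have "{C. \<mu> x C \<noteq> 0} \<union> {C. (\<psi> \<circ> \<phi>) x C \<noteq> 0} = {C \<in> \<C>. 0 < u C (\<phi> x)}"
      using \<mu>(3)[OF x] \<psi>(2)[OF \<phi>U[OF x]] by auto
    then show "{C. \<mu> x C \<noteq> 0} \<union> {C. (\<psi> \<circ> \<phi>) x C \<noteq> 0} \<in> ?K"
      using u_simplex[OF \<phi>U[OF x]] by simp
  qed (use \<mu> \<psi> \<phi>U in auto)
  ultimately have "homotopic_with (\<lambda>_. True) (nerve \<C>) (nerve \<C>) id (\<psi> \<circ> \<phi>)"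
    unfolding nerve geometric_realization_eq by (rule homotopic_with_trans)
  moreover have "continuous_map (nerve \<C>) (top_of_set (\<Union>\<C>)) \<phi>"
    unfolding nerve using \<phi>(1) \<phi>U by auto
  moreover have "continuous_map (top_of_set (\<Union>\<C>)) (nerve \<C>) \<psi>"
    unfolding nerve using \<psi> by auto
  ultimately show ?thesis using that by blast
qed

section \<open>Maps from the nerve to high-dimensional spheres\<close>

theorem theorem2:
  fixes X :: "'a::metric_space set" and \<C> :: "'a set set" and d r :: nat
    and f :: "('a set \<Rightarrow> real) \<Rightarrow> (nat \<Rightarrow> real)"
  assumes "convex_metric_space X" and "complete X"
    and "finite \<C>"
    and "\<And>C. C \<in> \<C> \<Longrightarrow> closedin (top_of_set X) C \<and> geodesically_convex X C"
    and "top_dim_le (top_of_set X) d"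
    and "d \<le> r"
    and "continuous_map (nerve \<C>) (nsphere r) f"
  shows "\<exists>p \<in> topspace (nsphere r). homotopic_with (\<lambda>_. True) (nerve \<C>) (nsphere r) f (\<lambda>_. p)"
proof -
  let ?Y = "\<Union>\<C>"
  obtain \<phi> \<psi> where \<phi>: "continuous_map (nerve \<C>) (top_of_set ?Y) \<phi>"
    and \<psi>: "continuous_map (top_of_set ?Y) (nerve \<C>) \<psi>"
    and retract: "homotopic_with (\<lambda>_. True) (nerve \<C>) (nerve \<C>) id (\<psi> \<circ> \<phi>)"
    using nerve_homotopy_retract[OF assms(1,3,4)] by blast
  have \<phi>Y: "\<phi> x \<in> ?Y" if "x \<in> topspace (nerve \<C>)" for x
    using Pi_mem[OF continuous_map_funspace[OF \<phi>] that] by simp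
  have Y: "closedin (top_of_set X) ?Y"
    using assms(3,4) by (intro closedin_Union) auto
  then have YX: "?Y \<subseteq> X" using closedin_subset by fastforce
  then have sub: "subtopology (top_of_set X) ?Y = top_of_set ?Y"
    by (simp add: subtopology_subtopology inf.absorb2)
  have "continuous_map (subtopology (top_of_set X) ?Y) (nsphere r) (f \<circ> \<psi>)"
    unfolding sub using \<psi> assms(7) by (rule continuous_map_compose)
  then obtain g where g: "continuous_map (top_of_set X) (nsphere r) g" "\<forall>y\<in>?Y. g y = (f \<circ> \<psi>) y"
    using assms(5,6) Y unfolding top_dim_le_def by metis
  have "contractible_space (top_of_set X)"
    using convex_metric_space_contractible[OF assms(1)] by simp
  then obtain p where p: "homotopic_with (\<lambda>_. True) (top_of_set X) (nsphere r) g (\<lambda>_. p)"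
    using nullhomotopic_from_contractible_space[OF g(1)] by blast
  obtain x where "x \<in> X" using assms(1) unfolding convex_metric_space_def by blast
  have "continuous_map (top_of_set X) (nsphere r) (\<lambda>_. p)"
    using homotopic_with_imp_continuous_maps[OF p] by blast
  from Pi_mem[OF continuous_map_funspace[OF this], of x]
  have "p \<in> topspace (nsphere r)"
    using \<open>x \<in> X\<close> by simp
  moreover have "homotopic_with (\<lambda>_. True) (nerve \<C>) (nsphere r) f (\<lambda>_. p)"
  proof -
    have 1: "homotopic_with (\<lambda>_. True) (nerve \<C>) (nsphere r) (f \<circ> id) (f \<circ> (\<psi> \<circ> \<phi>))"
      using retract assms(7) by (rule homotopic_with_compose_continuous_map_left) simp
    have 2: "homotopic_with (\<lambda>_. True) (nerve \<C>) (nsphere r) (f \<circ> (\<psi> \<circ> \<phi>)) (g \<circ> \<phi>)"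
    proof (rule homotopic_with_equal)
      show "continuous_map (nerve \<C>) (nsphere r) (f \<circ> (\<psi> \<circ> \<phi>))"
        using \<phi> \<psi> assms(7) by (intro continuous_map_compose)
      show "(f \<circ> (\<psi> \<circ> \<phi>)) x = (g \<circ> \<phi>) x" if "x \<in> topspace (nerve \<C>)" for x
        using bspec[OF g(2) \<phi>Y[OF that]] by simp
    qed auto
    have 3: "homotopic_with (\<lambda>_. True) (nerve \<C>) (nsphere r) (g \<circ> \<phi>) ((\<lambda>_. p) \<circ> \<phi>)"
    proof (rule homotopic_with_compose_continuous_map_right[OF p])
      show "continuous_map (nerve \<C>) (top_of_set X) \<phi>"
        using \<phi> unfolding sub[symmetric] by (rule continuous_map_into_fulltopology)
    qed simp
    show ?thesis
      using homotopic_with_trans[OF homotopic_with_trans[OF 1 2] 3] by (simp add: comp_def)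
  qed
  ultimately show ?thesis by blast
qed

end
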